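(* Let $G$ be a locally finite connected graph that is coarse Helly and has $\beta$-stable intervals for some $\beta\ge 1$. If a group $\Gamma$ acts geometrically on $G$, then $\Gamma$ is a Helly group.
   Context: Graphs are undirected and simple, with path metric $d$; $B_r(v)$ is the ball of radius $r$ about $v$, and $I(u,v)=\{x: d(u,x)+d(x,v)=d(u,v)\}$. $G$ is coarse Helly if there is $\delta\ge0$ such that for every family $\{B_{r_i}(x_i)\}_{i\in I}$ of pairwise intersecting balls, $\bigcap_{i\in I}B_{r_i+\delta}(x_i)\neq\emptyset$. $G$ has $\beta$-stable intervals if for all vertices $w,v,v'$ with $v,v'$ adjacent, the Hausdorff distance between $I(w,v)$ and $I(w,v')$ is at most $\beta$. A group acts geometrically on a locally finite graph if it acts by automorphisms, properly (finite stabilizers) and cocompactly. A graph is Helly if every family of pairwise intersecting balls has non-empty intersection; a group is Helly if it acts geometrically on a (locally finite) Helly graph. *)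

theory Defs
  imports
    "HOL-Algebra.Group_Action"
    "HOL-Library.Extended_Real"
    "HOL-Library.Countable_Set"
begin

text \<open>
  A graph is given by its vertex set and its adjacency relation; the symmetric pairs
  \<open>(u, v)\<close> and \<open>(v, u)\<close> together encode one undirected edge.
\<close>

definition simple_graph :: "'v set \<Rightarrow> 'v rel \<Rightarrow> bool" where
  "simple_graph V E \<longleftrightarrow> E \<subseteq> V \<times> V \<and> sym E \<and> irrefl E"

definition connected_graph :: "'v set \<Rightarrow> 'v rel \<Rightarrow> bool" where
  "connected_graph V E \<longleftrightarrow>
     simple_graph V E \<and> V \<noteq> {} \<and> (\<forall>u\<in>V. \<forall>v\<in>V. (u, v) \<in> E\<^sup>*)"

definition locally_finite_graph :: "'v set \<Rightarrow> 'v rel \<Rightarrow> bool" where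
  "locally_finite_graph V E \<longleftrightarrow> simple_graph V E \<and> (\<forall>v\<in>V. finite (E `` {v}))"

text \<open>
  The path metric. The relational power \<open>E ^^ n\<close> relates the endpoints of walks of length \<open>n\<close>.
  The value is meaningful for vertices in the same component only; all notions
  below are used for connected graphs.
\<close>

definition gdist :: "'v rel \<Rightarrow> 'v \<Rightarrow> 'v \<Rightarrow> nat" where
  "gdist E u v = (LEAST n. (u, v) \<in> E ^^ n)"

definition gball :: "'v set \<Rightarrow> 'v rel \<Rightarrow> 'v \<Rightarrow> real \<Rightarrow> 'v set" where
  "gball V E v r = {x \<in> V. real (gdist E v x) \<le> r}"

definition interval :: "'v set \<Rightarrow> 'v rel \<Rightarrow> 'v \<Rightarrow> 'v \<Rightarrow> 'v set" where
  "interval V E u v = {x \<in> V. gdist E u x + gdist E x v = gdist E u v}"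

text \<open>The value is infinite unless each set lies in a bounded neighbourhood of the other.\<close>

definition hausdorff_dist :: "'v set \<Rightarrow> 'v rel \<Rightarrow> 'v set \<Rightarrow> 'v set \<Rightarrow> ereal" where
  "hausdorff_dist V E A B =
     Inf {ereal \<epsilon> | \<epsilon>. 0 \<le> \<epsilon> \<and> A \<subseteq> (\<Union>b\<in>B. gball V E b \<epsilon>) \<and> B \<subseteq> (\<Union>a\<in>A. gball V E a \<epsilon>)}"

definition stable_intervals :: "'v set \<Rightarrow> 'v rel \<Rightarrow> real \<Rightarrow> bool" where
  "stable_intervals V E \<beta> \<longleftrightarrow>
     (\<forall>w\<in>V. \<forall>v\<in>V. \<forall>v'\<in>V. (v, v') \<in> E \<longrightarrow>
        hausdorff_dist V E (interval V E w v) (interval V E w v') \<le> ereal \<beta>)"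

text \<open>
  A family of balls is represented by the set \<open>F\<close> of its pairs (centre, radius); neither
  pairwise intersection nor the common intersection depends on how often a pair occurs, so
  families over arbitrary index sets are covered. The intersection is taken inside \<open>V\<close>, which
  only matters for the empty family.
\<close>

definition pairwise_intersecting :: "'v set \<Rightarrow> 'v rel \<Rightarrow> ('v \<times> real) set \<Rightarrow> bool" where
  "pairwise_intersecting V E F \<longleftrightarrow>
     (\<forall>(x, r)\<in>F. \<forall>(y, s)\<in>F. gball V E x r \<inter> gball V E y s \<noteq> {})"

definition coarse_helly :: "'v set \<Rightarrow> 'v rel \<Rightarrow> bool" where
  "coarse_helly V E \<longleftrightarrow>
     (\<exists>\<delta>\<ge>0. \<forall>F. F \<subseteq> V \<times> {0..} \<and> pairwise_intersecting V E F \<longrightarrow>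
        V \<inter> (\<Inter>(x, r)\<in>F. gball V E x (r + \<delta>)) \<noteq> {})"

definition helly_graph :: "'v set \<Rightarrow> 'v rel \<Rightarrow> bool" where
  "helly_graph V E \<longleftrightarrow> connected_graph V E \<and>
     (\<forall>F. F \<subseteq> V \<times> {0..} \<and> pairwise_intersecting V E F \<longrightarrow>
        V \<inter> (\<Inter>(x, r)\<in>F. gball V E x r) \<noteq> {})"

text \<open>
  Cocompactness is finiteness of the set of vertex orbits; as the graph is locally finite, there
  are then finitely many orbits of edges as well. That \<open>\<Gamma>\<close> is a group is part of the locale
  predicate \<open>group_action\<close>.
\<close>

definition geometric_action ::
    "('g, 'm) monoid_scheme \<Rightarrow> 'v set \<Rightarrow> 'v rel \<Rightarrow> ('g \<Rightarrow> 'v \<Rightarrow> 'v) \<Rightarrow> bool" where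
  "geometric_action \<Gamma> V E \<phi> \<longleftrightarrow>
     locally_finite_graph V E \<and>
     group_action \<Gamma> V \<phi> \<and>
     (\<forall>g\<in>carrier \<Gamma>. \<forall>u\<in>V. \<forall>v\<in>V. (\<phi> g u, \<phi> g v) \<in> E \<longleftrightarrow> (u, v) \<in> E) \<and>
     (\<forall>v\<in>V. finite (stabilizer \<Gamma> \<phi> v)) \<and>
     finite (orbits \<Gamma> V \<phi>)"

text \<open>
  HOL cannot quantify existentially over the type of vertices. Connected locally finite graphs
  are countable, so graphs with vertices in \<open>nat\<close> represent all of them up to isomorphism;
  lemma \<open>helly_groupI\<close> below shows that this loses nothing.
\<close>

definition helly_group :: "('g, 'm) monoid_scheme \<Rightarrow> bool" where
  "helly_group \<Gamma> \<longleftrightarrow>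
     (\<exists>(V :: nat set) E \<phi>. helly_graph V E \<and> geometric_action \<Gamma> V E \<phi>)"

lemma countable_verts:
  assumes c: "connected_graph V E" and l: "locally_finite_graph V E"
  shows "countable V"
proof -
  from c obtain v where v: "v \<in> V" by (auto simp: connected_graph_def)
  have EV: "E \<subseteq> V \<times> V" using c by (auto simp: connected_graph_def simple_graph_def)
  have fin: "finite ((E ^^ n) `` {v}) \<and> (E ^^ n) `` {v} \<subseteq> V" for n
  proof (induction n)
    case 0 then show ?case using v by auto
  next
    case (Suc n)
    have eq: "(E ^^ Suc n) `` {v} = (\<Union>u\<in>(E ^^ n) `` {v}. E `` {u})" by auto
    show ?case unfolding eq using Suc l EV by (fastforce simp: locally_finite_graph_def)
  qed
  have "V \<subseteq> (\<Union>n. (E ^^ n) `` {v})"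
    using c v by (fastforce simp: connected_graph_def rtrancl_power)
  moreover have "countable (\<Union>n. (E ^^ n) `` {v})"
    using fin by (intro countable_UN) (auto intro: countable_finite)
  ultimately show ?thesis by (rule countable_subset)
qed

lemma helly_groupI:
  fixes V :: "'v set"
  assumes h: "helly_graph V E" and a: "geometric_action \<Gamma> V E \<phi>"
  shows "helly_group \<Gamma>"
proof -
  have conn: "connected_graph V E" using h by (simp add: helly_graph_def)
  then have EV: "E \<subseteq> V \<times> V" and sE: "sym E" and iE: "irrefl E"
    by (auto simp: connected_graph_def simple_graph_def)
  have lf: "locally_finite_graph V E" and ga: "group_action \<Gamma> V \<phi>"
    and aut: "\<And>g u v. g \<in> carrier \<Gamma> \<Longrightarrow> u \<in> V \<Longrightarrow> v \<in> V \<Longrightarrow> (\<phi> g u, \<phi> g v) \<in> E \<longleftrightarrow> (u, v) \<in> E"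
    and st: "\<And>v. v \<in> V \<Longrightarrow> finite (stabilizer \<Gamma> \<phi> v)"
    and orb: "finite (orbits \<Gamma> V \<phi>)"
    using a by (auto simp: geometric_action_def)
  obtain f :: "'v \<Rightarrow> nat" where f: "inj_on f V"
    using countable_verts[OF conn lf] by (auto simp: countable_def)
  define V' where "V' = f ` V"
  define E' where "E' = map_prod f f ` E"
  define k where "k = inv_into V f"
  have kf: "k (f x) = x" if "x \<in> V" for x using f that by (simp add: k_def)
  define \<psi> where "\<psi> g = (\<lambda>x\<in>V'. f (\<phi> g (k x)))" for g
  have \<psi>f: "\<psi> g (f x) = f (\<phi> g x)" if "x \<in> V" for g x
    using that kf by (simp add: \<psi>_def V'_def)
  have E'iff: "(f u, f v) \<in> E' \<longleftrightarrow> (u, v) \<in> E" if "u \<in> V" "v \<in> V" for u v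
  proof
    assume "(f u, f v) \<in> E'"
    then obtain a b where ab: "(a, b) \<in> E" "f u = f a" "f v = f b" by (auto simp: E'_def)
    then have "a \<in> V" "b \<in> V" using EV by auto
    then have "u = a" "v = b" using ab that f by (auto dest: inj_onD)
    then show "(u, v) \<in> E" using ab by simp
  next
    assume "(u, v) \<in> E"
    then show "(f u, f v) \<in> E'" by (force simp: E'_def)
  qed
  have E'V: "E' \<subseteq> V' \<times> V'" using EV by (auto simp: E'_def V'_def)
  have pow: "(f u, f v) \<in> E' ^^ n \<longleftrightarrow> (u, v) \<in> E ^^ n" if "u \<in> V" "v \<in> V" for u v n
    using that(2)
  proof (induction n arbitrary: v)
    case 0 then show ?case using that(1) f by (auto dest: inj_onD)
  next
    case (Suc n)
    have "(f u, f v) \<in> E' ^^ Suc n \<longleftrightarrow> (\<exists>w\<in>V. (f u, f w) \<in> E' ^^ n \<and> (f w, f v) \<in> E')"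
      using E'V by (fastforce simp: V'_def)
    also have "\<dots> \<longleftrightarrow> (\<exists>w\<in>V. (u, w) \<in> E ^^ n \<and> (w, v) \<in> E)"
      using Suc E'iff by auto
    also have "\<dots> \<longleftrightarrow> (u, v) \<in> E ^^ Suc n" using EV by auto
    finally show ?case .
  qed
  have d: "gdist E' (f u) (f v) = gdist E u v" if "u \<in> V" "v \<in> V" for u v
    using pow[OF that] by (simp add: gdist_def)
  have ball: "gball V' E' (f x) r = f ` gball V E x r" if "x \<in> V" for x r
    using d that by (auto simp: gball_def V'_def)
  have ball_sub: "gball V E x r \<subseteq> V" for x r by (auto simp: gball_def)
  have simple': "simple_graph V' E'"
    unfolding simple_graph_def
  proof (intro conjI symI irreflI)
    fix x y assume xy: "(x, y) \<in> E'"
    then obtain u v where "x = f u" "y = f v" "u \<in> V" "v \<in> V" using E'V by (auto simp: V'_def)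
    then show "(y, x) \<in> E'" using xy E'iff sE by (auto dest: symD)
  next
    fix x show "(x, x) \<notin> E'"
    proof
      assume xx: "(x, x) \<in> E'"
      then obtain u where "x = f u" "u \<in> V" using E'V by (auto simp: V'_def)
      then show False using xx E'iff iE by (auto simp: irrefl_def)
    qed
  qed (rule E'V)
  have conn': "connected_graph V' E'"
    using simple' conn pow by (auto simp: connected_graph_def V'_def rtrancl_power)
  have helly': "helly_graph V' E'"
    unfolding helly_graph_def
  proof (intro conjI allI impI conn', elim conjE)
    fix F' assume F': "F' \<subseteq> V' \<times> {0..}" "pairwise_intersecting V' E' F'"
    define F where "F = {(x, r). x \<in> V \<and> (f x, r) \<in> F'}"
    have "F \<subseteq> V \<times> {0..}" using F'(1) by (auto simp: F_def)
    moreover have "pairwise_intersecting V E F"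
    proof -
      have "gball V E x r \<inter> gball V E y s \<noteq> {}" if xy: "(x, r) \<in> F" "(y, s) \<in> F" for x r y s
      proof -
        have V: "x \<in> V" "y \<in> V" and "(f x, r) \<in> F'" "(f y, s) \<in> F'"
          using xy by (auto simp: F_def)
        then have "gball V' E' (f x) r \<inter> gball V' E' (f y) s \<noteq> {}"
          using F'(2) unfolding pairwise_intersecting_def by blast
        then have "f ` (gball V E x r \<inter> gball V E y s) \<noteq> {}"
          using V by (simp add: ball inj_on_image_Int[OF f ball_sub ball_sub])
        then show ?thesis by blast
      qed
      then show ?thesis unfolding pairwise_intersecting_def by blast
    qed
    ultimately have "V \<inter> (\<Inter>(x, r)\<in>F. gball V E x r) \<noteq> {}"
      using h unfolding helly_graph_def by blast
    then obtain z where z: "z \<in> V" "\<And>x r. (x, r) \<in> F \<Longrightarrow> z \<in> gball V E x r"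
      by blast
    have "f z \<in> gball V' E' x r" if "(x, r) \<in> F'" for x r
    proof -
      from that F'(1) obtain x0 where "x = f x0" "x0 \<in> V" by (auto simp: V'_def)
      then show ?thesis using z(2)[of x0 r] that ball by (auto simp: F_def)
    qed
    then show "V' \<inter> (\<Inter>(x, r)\<in>F'. gball V' E' x r) \<noteq> {}"
      using z(1) by (auto simp: V'_def)
  qed
  interpret A: group_action \<Gamma> V \<phi> by (rule ga)
  have grp: "group \<Gamma>" using A.group_hom by (simp add: group_hom_def)
  have \<phi>V: "\<phi> g x \<in> V" if "g \<in> carrier \<Gamma>" "x \<in> V" for g x
    using A.element_image that by blast
  have bij: "\<psi> g \<in> Bij V'" if g: "g \<in> carrier \<Gamma>" for g
  proof -
    have "inj_on (\<psi> g) V'"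
    proof (rule inj_onI)
      fix x y assume "x \<in> V'" "y \<in> V'" "\<psi> g x = \<psi> g y"
      then show "x = y"
        using \<psi>f \<phi>V[OF g] A.inj_prop[OF g] f by (auto simp: V'_def inj_on_eq_iff)
    qed
    moreover have "\<psi> g ` V' = V'"
    proof -
      have "\<psi> g ` V' = f ` (\<phi> g ` V)"
        unfolding V'_def image_image using \<psi>f by (intro image_cong) auto
      then show ?thesis using A.surj_prop[OF g] by (simp add: V'_def)
    qed
    ultimately show ?thesis by (auto simp: Bij_def bij_betw_def \<psi>_def)
  qed
  have ga': "group_action \<Gamma> V' \<psi>"
  proof (intro group_action.intro group_hom.intro group_hom_axioms.intro grp group_BijGroup homI)
    fix g assume "g \<in> carrier \<Gamma>"
    then show "\<psi> g \<in> carrier (BijGroup V')" using bij by (simp add: BijGroup_def)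
  next
    fix g h assume gh: "g \<in> carrier \<Gamma>" "h \<in> carrier \<Gamma>"
    have "\<psi> (g \<otimes>\<^bsub>\<Gamma>\<^esub> h) = compose V' (\<psi> g) (\<psi> h)"
    proof (rule extensionalityI[of _ V'])
      fix x assume "x \<in> V'"
      then obtain x0 where "x = f x0" "x0 \<in> V" by (auto simp: V'_def)
      then show "\<psi> (g \<otimes>\<^bsub>\<Gamma>\<^esub> h) x = compose V' (\<psi> g) (\<psi> h) x"
        using gh \<phi>V \<psi>f A.composition_rule by (simp add: compose_def V'_def)
    qed (auto simp: \<psi>_def compose_def)
    then show "\<psi> (g \<otimes>\<^bsub>\<Gamma>\<^esub> h) = \<psi> g \<otimes>\<^bsub>BijGroup V'\<^esub> \<psi> h"
      using bij gh by (simp add: BijGroup_def)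
  qed
  have "geometric_action \<Gamma> V' E' \<psi>"
    unfolding geometric_action_def
  proof (intro conjI ga')
    show "locally_finite_graph V' E'"
    proof -
      have "E' `` {f v} = f ` (E `` {v})" if "v \<in> V" for v
      proof (intro equalityI subsetI)
        fix y assume y: "y \<in> E' `` {f v}"
        then obtain w where "y = f w" "w \<in> V" using E'V by (auto simp: V'_def)
        then show "y \<in> f ` (E `` {v})" using y that E'iff by auto
      next
        fix y assume "y \<in> f ` (E `` {v})"
        then show "y \<in> E' `` {f v}" using that EV E'iff by auto
      qed
      then show ?thesis using simple' lf by (auto simp: locally_finite_graph_def V'_def)
    qed
    show "\<forall>g\<in>carrier \<Gamma>. \<forall>u\<in>V'. \<forall>v\<in>V'. (\<psi> g u, \<psi> g v) \<in> E' \<longleftrightarrow> (u, v) \<in> E'"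
      using \<psi>f \<phi>V E'iff aut by (auto simp: V'_def)
    have "stabilizer \<Gamma> \<psi> (f v) = stabilizer \<Gamma> \<phi> v" if "v \<in> V" for v
      using that \<psi>f \<phi>V f by (auto simp: stabilizer_def inj_on_eq_iff)
    then show "\<forall>v\<in>V'. finite (stabilizer \<Gamma> \<psi> v)" using st by (auto simp: V'_def)
    have "orbit \<Gamma> \<psi> (f x) = f ` orbit \<Gamma> \<phi> x" if "x \<in> V" for x
      using that \<psi>f by (auto simp: orbit_def)
    then have "orbits \<Gamma> V' \<psi> \<subseteq> image f ` orbits \<Gamma> V \<phi>"
      by (auto simp: orbits_def V'_def)
    then show "finite (orbits \<Gamma> V' \<psi>)" using orb by (meson finite_imageI finite_subset)
  qed
  then show ?thesis using helly' by (auto simp: helly_group_def)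
qed

end

theory Submission
  imports Defs
begin

text \<open>
  The Helly graph on which \<open>\<Gamma>\<close> acts is the discrete injective hull (the Hellyfication) of
  \<open>G\<close>. Its vertices are the extremal functions: the pointwise minimal
  \<open>f : V \<rightarrow> \<nat>\<close> with \<open>d x y \<le> f x + f y\<close> for all \<open>x\<close>, \<open>y\<close>. Such an \<open>f\<close> lists the distances
  from a point that may be missing in \<open>G\<close>; the vertex \<open>x\<close> itself corresponds to \<open>d x\<close>.
  Two extremal functions are adjacent when they differ by at most one everywhere, and the
  path metric is then the supremum distance. For functions \<open>f\<^sub>i\<close> with radii \<open>r\<^sub>i\<close> whose balls
  pairwise intersect, any extremal function below \<open>min\<^sub>i (f\<^sub>i + r\<^sub>i)\<close> lies in all the balls
  (\<open>hull_common_point\<close>), so the hull is a Helly graph. All this holds for every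
  integer-valued metric. Isometries of \<open>V\<close> permute the extremal functions, so \<open>\<Gamma>\<close> acts on
  the hull, and the two hypotheses on \<open>G\<close> make this action geometric.
  
  The coarse Helly property, applied to the balls of radius \<open>f y\<close> about all vertices \<open>y\<close>,
  yields a vertex \<open>x\<close> at which \<open>f x\<close> is bounded by a constant independent of \<open>f\<close>
  (\<open>coarse_helly_near_vertex\<close>). After translating \<open>x\<close> to one of finitely many orbit
  representatives, cocompactness follows once it is known that for fixed \<open>x\<close> and \<open>c\<close> only
  finitely many extremal functions satisfy \<open>f x \<le> c\<close>. This also gives local finiteness, because
  adjacent functions differ by at most one at \<open>x\<close>.
  
  This claim (\<open>finite_hull_sublevel\<close>) is where stable intervals enter, twice. If
  \<open>f y + f z = d y z\<close>, then \<open>x\<close> is within a bounded error of lying between \<open>y\<close> and \<open>z\<close>, and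
  stability gives a point \<open>v\<close> of the interval from \<open>y\<close> to \<open>z\<close> in a bounded ball about \<open>x\<close>
  (\<open>interval_passes_near\<close>). Hence \<open>f y\<close> is the maximum of \<open>d y v + (d v z - f z)\<close> over the \<open>v\<close>
  in this ball and the \<open>z\<close> in the cone of all points that have \<open>v\<close> on a geodesic from
  \<open>y\<close>. Stability also shows that there are only finitely many such cones for each \<open>v\<close>
  (\<open>finite_cones\<close>, a version of Cannon's argument for cone types). So \<open>f\<close> is determined by
  finitely many bounded integers, one for each pair of a vertex \<open>v\<close> and a cone at \<open>v\<close>.
\<close>

lemma finite_image_factor:
  assumes "finite (p ` A)" and "\<And>x y. x \<in> A \<Longrightarrow> y \<in> A \<Longrightarrow> p x = p y \<Longrightarrow> c x = c y"
  shows "finite (c ` A)"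
proof -
  have "c x = c (inv_into A p (p x))" if "x \<in> A" for x
    using that by (intro assms(2)) (auto simp: inv_into_into f_inv_into_f)
  then have "c ` A \<subseteq> (\<lambda>q. c (inv_into A p q)) ` (p ` A)" by blast
  then show ?thesis using assms(1) by (rule finite_surj[rotated])
qed

section \<open>The injective hull of an integer-valued metric\<close>

locale nat_metric =
  fixes V :: "'v set" and d :: "'v \<Rightarrow> 'v \<Rightarrow> nat"
  assumes d_self: "x \<in> V \<Longrightarrow> d x x = 0"
    and d_sym: "x \<in> V \<Longrightarrow> y \<in> V \<Longrightarrow> d x y = d y x"
    and d_tri: "x \<in> V \<Longrightarrow> y \<in> V \<Longrightarrow> z \<in> V \<Longrightarrow> d x z \<le> d x y + d y z"
begin

text \<open>
  Attaining equality at every point expresses pointwise minimality. At a point with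
  \<open>f x = 0\<close> it holds with \<open>y = x\<close>. Values outside \<open>V\<close> are fixed by extensionality, so that
  equal points of the hull are equal functions.
\<close>

definition inj_hull :: "('v \<Rightarrow> nat) set" where
  "inj_hull = {f \<in> extensional V. (\<forall>x\<in>V. \<forall>y\<in>V. d x y \<le> f x + f y) \<and>
     (\<forall>x\<in>V. \<exists>y\<in>V. f x + f y = d x y)}"

text \<open>
  Supremum distance at most \<open>n\<close>; stated as a bound, it stays in the natural numbers.
\<close>

definition close :: "nat \<Rightarrow> ('v \<Rightarrow> nat) \<Rightarrow> ('v \<Rightarrow> nat) \<Rightarrow> bool" where
  "close n f g \<longleftrightarrow> (\<forall>x\<in>V. f x \<le> g x + n \<and> g x \<le> f x + n)"

definition hull_edges :: "('v \<Rightarrow> nat) rel" where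
  "hull_edges = {(f, g). f \<in> inj_hull \<and> g \<in> inj_hull \<and> f \<noteq> g \<and> close 1 f g}"

lemma hull_ge: "f \<in> inj_hull \<Longrightarrow> x \<in> V \<Longrightarrow> y \<in> V \<Longrightarrow> d x y \<le> f x + f y"
  by (auto simp: inj_hull_def)

lemma hull_attained:
  assumes "f \<in> inj_hull" "x \<in> V" obtains y where "y \<in> V" "f x + f y = d x y"
  using assms by (auto simp: inj_hull_def)

lemma hull_Lipschitz:
  assumes f: "f \<in> inj_hull" and V: "x \<in> V" "y \<in> V"
  shows "f x \<le> f y + d x y"
proof -
  obtain z where z: "z \<in> V" "f x + f z = d x z" using hull_attained[OF f V(1)] .
  show ?thesis using z d_tri[OF V(1,2) z(1)] hull_ge[OF f V(2) z(1)] by linarith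
qed

lemma hull_eqI:
  assumes "f \<in> inj_hull" "g \<in> inj_hull" "\<And>x. x \<in> V \<Longrightarrow> f x = g x" shows "f = g"
  using assms by (auto simp: inj_hull_def intro: extensionalityI)

lemma dist_in_hull:
  assumes x: "x \<in> V" shows "restrict (d x) V \<in> inj_hull"
proof -
  have "d y z \<le> d x y + d x z" if "y \<in> V" "z \<in> V" for y z
    using d_tri[OF that(1) x that(2)] d_sym[OF x that(1)] by simp
  moreover have "d x y + d x x = d y x" if "y \<in> V" for y
    using d_self[OF x] d_sym[OF x that] by simp
  ultimately show ?thesis using x unfolding inj_hull_def by auto
qed

text \<open>
  Zorn's lemma gives a minimal function: along a chain the pointwise infimum is attained at
  each point, and two points can be served by the same member of the chain. A minimal function
  attains equality everywhere, since otherwise one of its values could be lowered by one.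
\<close>

lemma exists_hull_below:
  assumes h: "\<And>x y. x \<in> V \<Longrightarrow> y \<in> V \<Longrightarrow> d x y \<le> h x + h y"
  obtains g where "g \<in> inj_hull" "\<And>x. x \<in> V \<Longrightarrow> g x \<le> h x"
proof -
  define A where "A = {f. (\<forall>x\<in>V. \<forall>y\<in>V. d x y \<le> f x + f y) \<and> f \<le> h}"
  have "\<exists>m\<in>A. \<forall>a\<in>A. a \<le> m \<longrightarrow> a = m"
  proof (rule predicate_Zorn)
    show "partial_order_on A (relation_of (\<lambda>f g. g \<le> f) A)"
      by (rule partial_order_on_relation_ofI) auto
    fix C assume C: "C \<in> Chains (relation_of (\<lambda>f g. g \<le> f) A)"
    then have CA: "C \<subseteq> A" and
      ch: "\<And>f g. f \<in> C \<Longrightarrow> g \<in> C \<Longrightarrow> f \<le> g \<or> g \<le> f"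
      by (auto simp: Chains_def relation_of_def)
    show "\<exists>u\<in>A. \<forall>a\<in>C. u \<le> a"
    proof (cases "C = {}")
      case True
      have "h \<in> A" using h by (auto simp: A_def)
      then show ?thesis using True by auto
    next
      case False
      define u where "u x = (INF f\<in>C. f x)" for x
      have u: "u \<le> f" if "f \<in> C" for f
        using that by (auto simp: u_def le_fun_def intro!: cINF_lower)
      have att: "\<exists>f\<in>C. u x = f x" for x
        using Inf_nat_def1[of "(\<lambda>f. f x) ` C"] False by (auto simp: u_def)
      have "d x y \<le> u x + u y" if V: "x \<in> V" "y \<in> V" for x y
      proof -
        obtain f g where fg: "f \<in> C" "u x = f x" "g \<in> C" "u y = g y" using att by meson
        have "d x y \<le> f x + f y" "d x y \<le> g x + g y" using fg CA V by (auto simp: A_def)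
        then show ?thesis using ch[OF fg(1,3)] fg unfolding le_fun_def
          by (smt (verit) add_le_mono le_trans order_refl)
      qed
      moreover have "u \<le> h"
      proof -
        obtain f where "f \<in> C" using False by blast
        then have "u \<le> f" "f \<le> h" using u CA by (auto simp: A_def)
        then show ?thesis by (rule order_trans)
      qed
      ultimately show ?thesis using u by (auto simp: A_def)
    qed
  qed
  then obtain m where m: "m \<in> A" and min: "\<And>a. a \<in> A \<Longrightarrow> a \<le> m \<Longrightarrow> a = m" by blast
  have mge: "d x y \<le> m x + m y" if "x \<in> V" "y \<in> V" for x y
    using m that by (auto simp: A_def)
  have "\<exists>y\<in>V. m x + m y = d x y" if x: "x \<in> V" for x
  proof (rule ccontr)
    assume no: "\<not> ?thesis"
    \<comment> \<open>The choice \<open>y = x\<close> is among the excluded ones.\<close>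
    then have pos: "m x > 0" using d_self[OF x] x by (metis add_0 bot_nat_0.not_eq_extremum)
    have gt: "d x y + 1 \<le> m x + m y" if "y \<in> V" for y
      using mge[OF x that] no that by (metis Suc_eq_plus1 Suc_leI le_neq_implies_less)
    define a where "a = m(x := m x - 1)"
    have "d y z \<le> a y + a z" if V: "y \<in> V" "z \<in> V" for y z
      using gt[OF V(1)] gt[OF V(2)] mge[OF V] pos d_sym[OF x V(1)] d_self[OF x]
      by (auto simp: a_def)
    moreover have am: "a \<le> m" by (auto simp: a_def le_fun_def)
    ultimately have "a = m" using m by (intro min) (auto simp: A_def)
    then show False using pos by (metis a_def diff_less fun_upd_same less_irrefl zero_less_one)
  qed
  then have "restrict m V \<in> inj_hull" using mge by (auto simp: inj_hull_def)
  moreover have "restrict m V x \<le> h x" if "x \<in> V" for x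
    using m that by (auto simp: A_def le_fun_def)
  ultimately show ?thesis by (rule that)
qed

text \<open>
  This is hyperconvexity of the hull. The function \<open>min\<^sub>i (f\<^sub>i + r\<^sub>i)\<close> satisfies the
  inequalities required of a point of the hull exactly because the \<open>f\<^sub>i\<close> are pairwise close
  enough. An extremal \<open>h\<close> below it satisfies \<open>h \<le> f\<^sub>i + r\<^sub>i\<close>; the reverse bound follows by
  evaluating \<open>h\<close> at a partner \<open>y\<close> of \<open>x\<close>, where \<open>f\<^sub>i x + f\<^sub>i y = d x y \<le> h x + h y\<close>.
\<close>

lemma hull_common_point:
  assumes F: "F \<subseteq> inj_hull \<times> UNIV" "F \<noteq> {}"
    and cl: "\<And>f r g s. (f, r) \<in> F \<Longrightarrow> (g, s) \<in> F \<Longrightarrow> close (r + s) f g"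
  obtains h where "h \<in> inj_hull" "\<And>f r. (f, r) \<in> F \<Longrightarrow> close r f h"
proof -
  define u where "u x = (INF (f, r)\<in>F. f x + r)" for x
  have low: "u x \<le> f x + r" if "(f, r) \<in> F" for f r x
    using cINF_lower[of "\<lambda>(f, r). f x + r" F "(f, r)"] that by (auto simp: u_def)
  have att: "\<exists>f r. (f, r) \<in> F \<and> u x = f x + r" for x
    using Inf_nat_def1[of "(\<lambda>(f, r). f x + r) ` F"] F(2) by (fastforce simp: u_def)
  have "d x y \<le> u x + u y" if V: "x \<in> V" "y \<in> V" for x y
  proof -
    obtain f r g s where fg: "(f, r) \<in> F" "u x = f x + r" "(g, s) \<in> F" "u y = g y + s"
      using att by meson
    have "f y \<le> g y + (r + s)" using cl[OF fg(1,3)] V by (auto simp: close_def)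
    moreover have "d x y \<le> f x + f y" using F(1) fg(1) V by (auto intro: hull_ge)
    ultimately show ?thesis using fg by linarith
  qed
  then obtain h where h: "h \<in> inj_hull" "\<And>x. x \<in> V \<Longrightarrow> h x \<le> u x"
    by (rule exists_hull_below) auto
  have "close r f h" if fr: "(f, r) \<in> F" for f r
    unfolding close_def
  proof (intro ballI conjI)
    fix x assume x: "x \<in> V"
    have f: "f \<in> inj_hull" using F(1) fr by auto
    show "h x \<le> f x + r" using h(2)[OF x] low[OF fr, of x] by linarith
    obtain y where y: "y \<in> V" "f x + f y = d x y" using hull_attained[OF f x] .
    show "f x \<le> h x + r"
      using y hull_ge[OF h(1) x y(1)] h(2)[OF y(1)] low[OF fr, of y] by linarith
  qed
  then show ?thesis using h(1) that by blast
qed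

lemma hull_close_value_sum:
  assumes f: "f \<in> inj_hull" and g: "g \<in> inj_hull" and x: "x \<in> V"
  shows "close (f x + g x) f g"
  unfolding close_def
proof (intro ballI conjI)
  fix y assume y: "y \<in> V"
  show "f y \<le> g y + (f x + g x)"
    using hull_Lipschitz[OF f y x] hull_ge[OF g y x] by linarith
  show "g y \<le> f y + (f x + g x)"
    using hull_Lipschitz[OF g y x] hull_ge[OF f y x] by linarith
qed

lemma close_if_walk: "(f, g) \<in> hull_edges ^^ n \<Longrightarrow> close n f g"
proof (induction n arbitrary: g)
  case 0 then show ?case by (auto simp: close_def)
next
  case (Suc n)
  then obtain k where k: "(f, k) \<in> hull_edges ^^ n" "(k, g) \<in> hull_edges" by auto
  then have "close n f k" "close 1 k g" using Suc.IH by (auto simp: hull_edges_def)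
  then show ?case by (fastforce simp: close_def)
qed

text \<open>
  The balls of radius \<open>n\<close> about \<open>f\<close> and of radius \<open>1\<close> about \<open>g\<close> have a common point, which
  serves as the last vertex before \<open>g\<close> on a walk.
\<close>

lemma walk_if_close:
  "f \<in> inj_hull \<Longrightarrow> g \<in> inj_hull \<Longrightarrow> close n f g \<Longrightarrow> \<exists>m\<le>n. (f, g) \<in> hull_edges ^^ m"
proof (induction n arbitrary: g)
  case 0
  then have "f = g" by (intro hull_eqI) (auto simp: close_def)
  then show ?case by auto
next
  case (Suc n)
  define F where "F = {(f, n), (g, 1)}"
  have "close (r + s) k l" if "(k, r) \<in> F" "(l, s) \<in> F" for k r l s
    using that Suc.prems(3) by (auto simp: F_def close_def le_add1)
  moreover have "F \<subseteq> inj_hull \<times> UNIV" "F \<noteq> {}" using Suc.prems by (auto simp: F_def)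
  ultimately obtain k where k: "k \<in> inj_hull" "\<And>l r. (l, r) \<in> F \<Longrightarrow> close r l k"
    by (metis hull_common_point)
  then have "close n f k" "close 1 g k" by (auto simp: F_def)
  then obtain m where m: "m \<le> n" "(f, k) \<in> hull_edges ^^ m" using Suc k by blast
  show ?case
  proof (cases "k = g")
    case True then show ?thesis using m le_SucI by blast
  next
    case False
    then have "(k, g) \<in> hull_edges"
      using k(1) Suc.prems \<open>close 1 g k\<close> by (auto simp: hull_edges_def close_def)
    then have "(f, g) \<in> hull_edges ^^ Suc m" using m by auto
    then show ?thesis using m by blast
  qed
qed

lemma hull_simple: "simple_graph inj_hull hull_edges"
  by (auto simp: simple_graph_def hull_edges_def sym_def irrefl_def close_def)

lemma hull_connected:
  assumes "V \<noteq> {}" shows "connected_graph inj_hull hull_edges"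
proof -
  obtain x where x: "x \<in> V" using assms by blast
  have "(f, g) \<in> hull_edges\<^sup>*" if "f \<in> inj_hull" "g \<in> inj_hull" for f g
    using walk_if_close[OF that hull_close_value_sum[OF that x]] relpow_imp_rtrancl by metis
  moreover have "inj_hull \<noteq> {}" using dist_in_hull[OF x] by blast
  ultimately show ?thesis using hull_simple unfolding connected_graph_def by blast
qed

lemma hull_gdist_le_iff:
  assumes V: "V \<noteq> {}" and f: "f \<in> inj_hull" and g: "g \<in> inj_hull"
  shows "gdist hull_edges f g \<le> n \<longleftrightarrow> close n f g"
proof
  assume le: "gdist hull_edges f g \<le> n"
  have "\<exists>m. (f, g) \<in> hull_edges ^^ m"
    using hull_connected[OF V] f g rtrancl_imp_relpow unfolding connected_graph_def by metis
  then have "close (gdist hull_edges f g) f g"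
    unfolding gdist_def by (intro close_if_walk) (rule LeastI_ex)
  then show "close n f g" using le unfolding close_def by (meson add_left_mono order_trans)
next
  assume "close n f g"
  then obtain m where "m \<le> n" "(f, g) \<in> hull_edges ^^ m" using walk_if_close f g by blast
  then show "gdist hull_edges f g \<le> n" unfolding gdist_def by (meson Least_le le_trans)
qed

text \<open>
  Distances are integers, so real radii may be rounded down.
\<close>

lemma hull_helly:
  assumes V: "V \<noteq> {}" shows "helly_graph inj_hull hull_edges"
  unfolding helly_graph_def
proof (intro conjI allI impI hull_connected[OF V], elim conjE)
  fix F assume F: "F \<subseteq> inj_hull \<times> {0..}" and pw: "pairwise_intersecting inj_hull hull_edges F"
  have ball: "g \<in> gball inj_hull hull_edges f r \<longleftrightarrow> g \<in> inj_hull \<and> close (nat \<lfloor>r\<rfloor>) f g"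
    if "f \<in> inj_hull" "0 \<le> r" for f g r
    using that hull_gdist_le_iff[OF V that(1), of g "nat \<lfloor>r\<rfloor>"]
    by (auto simp: gball_def le_nat_floor) (metis le_nat_floor of_nat_floor of_nat_le_iff order_trans)+
  show "inj_hull \<inter> (\<Inter>(f, r)\<in>F. gball inj_hull hull_edges f r) \<noteq> {}"
  proof (cases "F = {}")
    case True
    then show ?thesis using V dist_in_hull by auto
  next
    case False
    define F' where "F' = (\<lambda>(f, r). (f, nat \<lfloor>r\<rfloor>)) ` F"
    have "close (r + s) f g" if fg: "(f, r) \<in> F'" "(g, s) \<in> F'" for f r g s
    proof -
      obtain a b where ab: "(f, a) \<in> F" "r = nat \<lfloor>a\<rfloor>" "(g, b) \<in> F" "s = nat \<lfloor>b\<rfloor>"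
        using fg by (auto simp: F'_def)
      then obtain k where "k \<in> gball inj_hull hull_edges f a" "k \<in> gball inj_hull hull_edges g b"
        using pw unfolding pairwise_intersecting_def by blast
      then have "close r f k" "close s g k" using ball F ab by auto
      then show ?thesis by (fastforce simp: close_def)
    qed
    moreover have "F' \<subseteq> inj_hull \<times> UNIV" "F' \<noteq> {}" using F False by (auto simp: F'_def)
    ultimately obtain h where h: "h \<in> inj_hull" "\<And>f r. (f, r) \<in> F' \<Longrightarrow> close r f h"
      by (metis hull_common_point)
    have "h \<in> gball inj_hull hull_edges f r" if "(f, r) \<in> F" for f r
      using h that F ball by (force simp: F'_def)
    then show ?thesis using h(1) by auto
  qed
qed

end


section \<open>Connected graphs\<close>

locale conn_graph =
  fixes V :: "'v set" and E :: "'v rel"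
  assumes conn: "connected_graph V E"
begin

lemma edge_verts: "E \<subseteq> V \<times> V" and edge_sym: "(x, y) \<in> E \<Longrightarrow> (y, x) \<in> E"
  using conn by (auto simp: connected_graph_def simple_graph_def dest: symD)

lemma gdist_walk: "x \<in> V \<Longrightarrow> y \<in> V \<Longrightarrow> (x, y) \<in> E ^^ gdist E x y"
  unfolding gdist_def
  using conn rtrancl_imp_relpow unfolding connected_graph_def by (metis LeastI_ex)

lemma gdist_le: "(x, y) \<in> E ^^ n \<Longrightarrow> gdist E x y \<le> n"
  unfolding gdist_def by (rule Least_le)

lemma walk_rev: "(x, y) \<in> E ^^ n \<Longrightarrow> (y, x) \<in> E ^^ n"
proof (induction n arbitrary: y)
  case (Suc n)
  from Suc.prems obtain z where "(x, z) \<in> E ^^ n" "(z, y) \<in> E" by (rule relpow_Suc_E)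
  then show ?case by (intro relpow_Suc_I2[OF edge_sym] Suc.IH)
qed simp

sublocale nat_metric V "gdist E"
proof
  show "gdist E x x = 0" for x using gdist_le[of x x 0] by simp
  show "gdist E x y = gdist E y x" if "x \<in> V" "y \<in> V" for x y
    using that by (meson gdist_le gdist_walk walk_rev le_antisym)
  show "gdist E x z \<le> gdist E x y + gdist E y z" if "x \<in> V" "y \<in> V" "z \<in> V" for x y z
    using gdist_walk[OF that(1,2)] gdist_walk[OF that(2,3)]
    by (intro gdist_le) (auto simp: relpow_add)
qed

lemma last_step:
  assumes V: "x \<in> V" "z \<in> V" and n: "gdist E x z = Suc n"
  obtains z' where "z' \<in> V" "(z', z) \<in> E" "gdist E x z' = n" "gdist E z' z \<le> 1"
proof -
  have "(x, z) \<in> E ^^ Suc n" using gdist_walk[OF V] by (simp only: n)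
  then obtain z' where z': "(x, z') \<in> E ^^ n" "(z', z) \<in> E" by (rule relpow_Suc_E)
  then have V': "z' \<in> V" using edge_verts by auto
  have one: "gdist E z' z \<le> 1" using z'(2) by (intro gdist_le) simp
  then have "gdist E x z' = n" using gdist_le[OF z'(1)] d_tri[OF V(1) V' V(2)] n by linarith
  then show ?thesis using that V' z' one by blast
qed

lemma split_geodesic:
  assumes V: "x \<in> V" "y \<in> V" and le: "gdist E x y \<le> a + b"
  obtains z where "z \<in> V" "gdist E x z \<le> a" "gdist E z y \<le> b"
proof (cases "gdist E x y \<le> a")
  case True
  then show ?thesis using that[of y] V d_self by simp
next
  case False
  have "(x, y) \<in> E ^^ (a + (gdist E x y - a))" using gdist_walk[OF V] False by simp
  then obtain z where z: "(x, z) \<in> E ^^ a" "(z, y) \<in> E ^^ (gdist E x y - a)"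
    unfolding relpow_add by blast
  have "z \<in> V"
  proof (cases "a = 0")
    case True then show ?thesis using z V by simp
  next
    case False
    then obtain n where "a = Suc n" by (cases a) auto
    then show ?thesis using z(1) edge_verts by auto
  qed
  then show ?thesis using that z[THEN gdist_le] le by force
qed

lemma finite_balls:
  assumes lf: "locally_finite_graph V E" and x: "x \<in> V"
  shows "finite {y \<in> V. gdist E x y \<le> n}"
proof (induction n)
  case 0
  have "{y \<in> V. gdist E x y \<le> 0} \<subseteq> {x}" using gdist_walk[OF x] by fastforce
  then show ?case by (rule finite_subset) simp
next
  case (Suc n)
  let ?B = "{y \<in> V. gdist E x y \<le> n}"
  have "{y \<in> V. gdist E x y \<le> Suc n} \<subseteq> ?B \<union> (\<Union>z\<in>?B. E `` {z})"
  proof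
    fix y assume y: "y \<in> {y \<in> V. gdist E x y \<le> Suc n}"
    show "y \<in> ?B \<union> (\<Union>z\<in>?B. E `` {z})"
    proof (cases "gdist E x y = Suc n")
      case True
      then obtain z where "z \<in> V" "(z, y) \<in> E" "gdist E x z = n" using last_step x y by blast
      then show ?thesis by blast
    next
      case False
      then show ?thesis using y by auto
    qed
  qed
  moreover have "finite (?B \<union> (\<Union>z\<in>?B. E `` {z}))"
    using Suc lf by (auto simp: locally_finite_graph_def)
  ultimately show ?case by (rule finite_subset)
qed

text \<open>
  The balls of radius \<open>f y\<close> about all \<open>y\<close> intersect pairwise because \<open>d y z \<le> f y + f z\<close>
  and geodesics can be subdivided. Let \<open>x\<close> lie in all of their \<open>\<delta>\<close>-enlargements and let \<open>y\<close> be
  a partner of \<open>x\<close>. Then \<open>f x + f y = d x y \<le> f y + \<delta>\<close>.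
\<close>

lemma coarse_helly_near_vertex:
  assumes "coarse_helly V E"
  shows "\<exists>N. \<forall>f\<in>inj_hull. \<exists>x\<in>V. f x \<le> N"
proof -
  from assms obtain \<delta> :: real where
    ch: "\<forall>F. F \<subseteq> V \<times> {0..} \<and> pairwise_intersecting V E F \<longrightarrow>
      V \<inter> (\<Inter>(x, r)\<in>F. gball V E x (r + \<delta>)) \<noteq> {}"
    unfolding coarse_helly_def by (elim exE conjE)
  have "\<exists>x\<in>V. f x \<le> nat \<lfloor>\<delta>\<rfloor>" if f: "f \<in> inj_hull" for f
  proof -
    define F where "F = (\<lambda>y. (y, real (f y))) ` V"
    have "gball V E y (real (f y)) \<inter> gball V E z (real (f z)) \<noteq> {}"
      if yz: "y \<in> V" "z \<in> V" for y z
    proof -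
      obtain w where w: "w \<in> V" "gdist E y w \<le> f y" "gdist E w z \<le> f z"
        using split_geodesic[OF yz hull_ge[OF f yz]] .
      then have "w \<in> gball V E y (real (f y)) \<inter> gball V E z (real (f z))"
        using d_sym[OF w(1) yz(2)] by (simp add: gball_def)
      then show ?thesis by blast
    qed
    then have "pairwise_intersecting V E F"
      unfolding pairwise_intersecting_def F_def by blast
    moreover have "F \<subseteq> V \<times> {0..}" by (auto simp: F_def)
    ultimately have "V \<inter> (\<Inter>(x, r)\<in>F. gball V E x (r + \<delta>)) \<noteq> {}"
      using ch by metis
    then obtain x where x: "x \<in> V" and in_balls: "x \<in> (\<Inter>(x, r)\<in>F. gball V E x (r + \<delta>))"
      by blast
    obtain y where y: "y \<in> V" "f x + f y = gdist E x y" using hull_attained[OF f x] .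
    have "x \<in> gball V E y (real (f y) + \<delta>)"
      using in_balls y(1) unfolding F_def by blast
    then have "real (gdist E x y) \<le> real (f y) + \<delta>"
      using d_sym[OF x y(1)] by (simp add: gball_def)
    then have "real (f x) \<le> \<delta>" unfolding y(2)[symmetric] by simp
    then have "f x \<le> nat \<lfloor>\<delta>\<rfloor>" by (rule le_nat_floor)
    then show ?thesis using x by blast
  qed
  then show ?thesis by blast
qed

end

section \<open>Cones and extremal functions under stable intervals\<close>

text \<open>
  One direction of the Hausdorff bound suffices, since \<open>v\<close> and \<open>v'\<close> may be exchanged.
\<close>

locale stable_graph = conn_graph V E for V :: "'v set" and E +
  fixes k :: nat
  assumes stable: "w \<in> V \<Longrightarrow> (v, v') \<in> E \<Longrightarrow> a \<in> interval V E w v \<Longrightarrow>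
    \<exists>b\<in>interval V E w v'. gdist E a b \<le> k"
begin

text \<open>
  Move along a geodesic from \<open>x\<close> to \<open>z\<close>, starting with the interval from \<open>y\<close> to \<open>x\<close>, which
  contains \<open>x\<close>. A step that increases the distance from \<open>y\<close> enlarges the interval, so nothing
  is lost. Every other step uses up at least one unit of the excess \<open>c\<close>, and costs at most \<open>k\<close> by
  stability. This is why the bound is \<open>c * k\<close> and does not depend on the distance to \<open>z\<close>.
\<close>

lemma interval_passes_near:
  assumes "x \<in> V" "y \<in> V" "z \<in> V" "gdist E y x + gdist E x z \<le> gdist E y z + c"
  shows "\<exists>v\<in>interval V E y z. gdist E x v \<le> c * k"
  using assms(3,4)
proof (induction "gdist E x z" arbitrary: z c)
  case 0
  then have "x \<in> interval V E y z"
    using assms(1,2) d_tri[of y x z] d_tri[of y z x] d_sym[of x z]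
    by (simp add: interval_def)
  then show ?case using d_self[OF assms(1)] by force
next
  case (Suc n)
  note x = assms(1) and y = assms(2) and z = Suc.prems(1)
  obtain z' where z': "z' \<in> V" "(z', z) \<in> E" "gdist E x z' = n" "gdist E z' z \<le> 1"
    using last_step[OF x z] Suc.hyps(2) by metis
  show ?case
  proof (cases "gdist E y z = gdist E y z' + 1")
    case True
    then obtain v where v: "v \<in> interval V E y z'" "gdist E x v \<le> c * k"
      using Suc.hyps(1)[of z' c] Suc.hyps(2) Suc.prems z' by auto
    then have V: "v \<in> V" by (simp add: interval_def)
    have "v \<in> interval V E y z"
      using v(1) True z'(4) d_tri[OF V z'(1) z] d_tri[OF y V z] by (simp add: interval_def)
    then show ?thesis using v by blast
  next
    case False
    then have le: "gdist E y z \<le> gdist E y z'" using d_tri[OF y z'(1) z] z'(4) by linarith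
    have "c \<noteq> 0"
      using le Suc.hyps(2) Suc.prems(2) d_tri[OF y x z'(1)] z'(3) by linarith
    then obtain c' where c: "c = Suc c'" by (cases c) auto
    then obtain v where v: "v \<in> interval V E y z'" "gdist E x v \<le> c' * k"
      using Suc.hyps(1)[of z' c'] Suc.hyps(2) Suc.prems z' le by auto
    obtain u where u: "u \<in> interval V E y z" "gdist E v u \<le> k"
      using stable[OF y z'(2) v(1)] by blast
    have "gdist E x u \<le> c * k"
      using d_tri[of x v u] x u v c by (simp add: interval_def)
    then show ?thesis using u by blast
  qed
qed

definition cone :: "'v \<Rightarrow> 'v \<Rightarrow> 'v set" where
  "cone y v = {z \<in> V. v \<in> interval V E y z}"

text \<open>
  The cone at \<open>v\<close> is determined by the distances from \<open>y\<close> to the vertices near \<open>v\<close>, relative to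
  the distance from \<open>y\<close> to \<open>v\<close>. The induction extends a geodesic from \<open>v\<close> by one edge
  from \<open>z'\<close> to \<open>z\<close>. By stability, the interval from \<open>y'\<close> to \<open>z\<close> still has a point \<open>u\<close> near \<open>v\<close>;
  if going through \<open>u\<close> were shorter than going through \<open>v\<close> when starting from \<open>y'\<close>, then it would
  be shorter when starting from \<open>y\<close> as well.
\<close>

lemma cone_mono_profile:
  assumes V: "y \<in> V" "y' \<in> V" "v \<in> V"
    and prof: "\<And>u. u \<in> V \<Longrightarrow> gdist E v u \<le> k \<Longrightarrow>
      gdist E y u + gdist E y' v = gdist E y' u + gdist E y v"
  shows "cone y v \<subseteq> cone y' v"
proof
  fix z assume "z \<in> cone y v"
  then show "z \<in> cone y' v"
  proof (induction "gdist E v z" arbitrary: z)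
    case 0
    then have "z \<in> V" by (simp add: cone_def)
    then show ?case
      using 0 V d_tri[of y' v z] d_tri[of y' z v] d_sym[of v z]
      by (simp add: cone_def interval_def)
  next
    case (Suc n)
    then have z: "z \<in> V" and on: "gdist E y v + gdist E v z = gdist E y z"
      by (auto simp: cone_def interval_def)
    obtain z' where z': "z' \<in> V" "(z', z) \<in> E" "gdist E v z' = n" "gdist E z' z \<le> 1"
      using last_step[OF V(3) z] Suc.hyps(2) by metis
    have "z' \<in> cone y v"
      using on z' Suc.hyps(2) d_tri[OF V(1,3) z'(1)] d_tri[OF V(1) z'(1) z] V
      by (simp add: cone_def interval_def)
    then have "z' \<in> cone y' v" using Suc.hyps(1) z'(3) by blast
    then have on': "v \<in> interval V E y' z'" by (simp add: cone_def)
    then obtain u where u: "u \<in> V" "gdist E v u \<le> k"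
      "gdist E y' u + gdist E u z = gdist E y' z"
      using stable[OF V(2) z'(2)] by (auto simp: interval_def)
    have "gdist E y' v + gdist E v z \<le> gdist E y' z"
      using prof[OF u(1,2)] u(3) on d_tri[OF V(1) u(1) z] by linarith
    then show ?case
      using d_tri[OF V(2,3) z] V z by (simp add: cone_def interval_def)
  qed
qed

lemma finite_cones:
  assumes lf: "locally_finite_graph V E" and v: "v \<in> V"
  shows "finite ((\<lambda>y. cone y v) ` V)"
proof -
  define B where "B = {u \<in> V. gdist E v u \<le> k}"
  \<comment> \<open>The relative distance lies between \<open>-k\<close> and \<open>k\<close>; adding \<open>k\<close> keeps it a natural number.\<close>
  define p where "p y = (\<lambda>u\<in>B. gdist E y u + k - gdist E y v)" for y
  have fB: "finite B" unfolding B_def by (rule finite_balls[OF lf v])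
  have "p ` V \<subseteq> B \<rightarrow>\<^sub>E {..2 * k}"
  proof clarify
    fix y assume y: "y \<in> V"
    have "gdist E y u + k - gdist E y v \<le> 2 * k" if "u \<in> B" for u
      using that d_tri[OF y v, of u] by (auto simp: B_def)
    then show "p y \<in> B \<rightarrow>\<^sub>E {..2 * k}" by (auto simp: p_def)
  qed
  then have fin: "finite (p ` V)"
    using fB by (meson finite_PiE finite_atMost finite_subset)
  have sub: "cone y v \<subseteq> cone y' v" if V: "y \<in> V" "y' \<in> V" and eq: "p y = p y'" for y y'
  proof (rule cone_mono_profile[OF V v])
    fix u assume u: "u \<in> V" "gdist E v u \<le> k"
    have "p y u = p y' u" using eq by simp
    moreover have "gdist E y v \<le> gdist E y u + k" "gdist E y' v \<le> gdist E y' u + k"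
      using d_tri[OF V(1) u(1) v] d_tri[OF V(2) u(1) v] u d_sym[OF v u(1)] by auto
    ultimately show "gdist E y u + gdist E y' v = gdist E y' u + gdist E y v"
      using u by (simp add: p_def B_def)
  qed
  show ?thesis
    by (rule finite_image_factor[OF fin]) (simp add: sub subset_antisym)
qed

text \<open>
  A function \<open>f\<close> with \<open>f x \<le> c\<close> is encoded by the set of values \<open>d v z - f z\<close>, for
  \<open>z\<close> in a cone, for each of the finitely many pairs of a vertex \<open>v\<close> near \<open>x\<close> and a cone at
  \<open>v\<close>. These values lie between \<open>-f v\<close> and \<open>f v\<close>, so there are finitely many codes.
  The code determines \<open>f\<close>: let \<open>z\<close> be a partner of \<open>y\<close> for \<open>f\<close>, with \<open>v\<close> on a geodesic from \<open>y\<close>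
  to \<open>z\<close>. If \<open>g\<close> has the same code, it takes the value \<open>d v z - f z\<close> at some \<open>z'\<close> in the same
  cone, and then \<open>g y \<ge> d y z' - g z' = d y v + (d v z' - g z') = d y v + (d v z - f z) = f y\<close>.
\<close>

lemma finite_hull_sublevel:
  assumes lf: "locally_finite_graph V E" and x: "x \<in> V"
  shows "finite {f \<in> inj_hull. f x \<le> c}"
proof -
  \<comment> \<open>\<open>R\<close> comes from \<open>interval_passes_near\<close> with excess \<open>2 * c\<close>. As \<open>M\<close> bounds \<open>f\<close> on the ball \<open>B\<close>,
    adding it makes the encoded values natural numbers.\<close>
  define R where "R = 2 * c * k"
  define M where "M = c + R"
  define B where "B = {v \<in> V. gdist E x v \<le> R}"
  define T where "T = Sigma B (\<lambda>v. (\<lambda>y. cone y v) ` V)"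
  define code where "code f = (\<lambda>(v, A)\<in>T. {gdist E v z + M - f z | z. z \<in> A})" for f
  let ?S = "{f \<in> inj_hull. f x \<le> c}"
  have fT: "finite T" unfolding T_def B_def
    using finite_balls[OF lf x] finite_cones[OF lf] by auto
  have fv: "f v \<le> M" if "f \<in> ?S" "v \<in> B" for f v
    using that hull_Lipschitz[of f v x] x d_sym[of v x] by (auto simp: B_def M_def)
  have "code ` ?S \<subseteq> T \<rightarrow>\<^sub>E Pow {..2 * M}"
  proof clarify
    fix f assume f: "f \<in> inj_hull" "f x \<le> c"
    have "gdist E v z + M - f z \<le> 2 * M" if "v \<in> B" "z \<in> V" for v z
      using that f fv[of f v] hull_ge[of f v z] by (auto simp: B_def)
    then show "code f \<in> T \<rightarrow>\<^sub>E Pow {..2 * M}"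
      by (auto simp: code_def T_def cone_def split: prod.splits)
  qed
  then have fin: "finite (code ` ?S)"
    using fT by (meson finite_PiE finite_Pow_iff finite_atMost finite_subset)
  have le: "f y \<le> g y" if f: "f \<in> ?S" and g: "g \<in> ?S" and eq: "code f = code g" and y: "y \<in> V"
    for f g y
  proof -
    obtain z where z: "z \<in> V" "f y + f z = gdist E y z"
      using hull_attained[of f y] f y by auto
    have "gdist E y x + gdist E x z \<le> gdist E y z + 2 * c"
      using z f hull_Lipschitz[of f x y] hull_ge[of f y x] hull_ge[of f x z] x y by force
    then obtain v where v: "v \<in> interval V E y z" "gdist E x v \<le> R"
      using interval_passes_near[OF x y z(1)] by (auto simp: R_def)
    have vV: "v \<in> V" and sum: "gdist E y v + gdist E v z = gdist E y z"
      using v(1) by (auto simp: interval_def)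
    have vB: "v \<in> B" using v vV by (simp add: B_def)
    have T: "(v, cone y v) \<in> T" using vB y by (auto simp: T_def)
    have "gdist E v z + M - f z \<in> code f (v, cone y v)"
      using T z v by (auto simp: code_def cone_def)
    then have "gdist E v z + M - f z \<in> code g (v, cone y v)" by (simp add: eq)
    then obtain z' where z': "z' \<in> cone y v" "gdist E v z + M - f z = gdist E v z' + M - g z'"
      using T by (auto simp: code_def)
    have z'V: "z' \<in> V" and sum': "gdist E y v + gdist E v z' = gdist E y z'"
      using z'(1) by (auto simp: cone_def interval_def)
    have "f z \<le> gdist E v z + M" "g z' \<le> gdist E v z' + M"
      using fv[OF f vB] fv[OF g vB] hull_Lipschitz[of f z v] hull_Lipschitz[of g z' v]
        f g z z'V vV d_sym[of v z] d_sym[of v z'] by auto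
    then have "gdist E v z + g z' = gdist E v z' + f z" using z'(2) by linarith
    moreover have "gdist E y z' \<le> g y + g z'" using g y z'V hull_ge by blast
    ultimately show ?thesis using sum sum' z(2) by linarith
  qed
  have "inj_on code ?S"
  proof (rule inj_onI)
    fix f g assume fg: "f \<in> ?S" "g \<in> ?S" and eq: "code f = code g"
    show "f = g" using fg le[OF fg eq] le[OF fg(2,1) eq[symmetric]]
      by (intro hull_eqI) (auto intro: le_antisym)
  qed
  then show ?thesis using fin finite_imageD by blast
qed

end

section \<open>The induced action on the injective hull\<close>

locale isometric_action = nat_metric V d + group_action \<Gamma> V \<phi>
  for V :: "'v set" and d and \<Gamma> (structure) and \<phi> +
  assumes isom: "g \<in> carrier \<Gamma> \<Longrightarrow> x \<in> V \<Longrightarrow> y \<in> V \<Longrightarrow> d (\<phi> g x) (\<phi> g y) = d x y"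
begin

lemma grp: "group \<Gamma>" using group_hom by (simp add: group_hom_def)

lemma act_in: "g \<in> carrier \<Gamma> \<Longrightarrow> x \<in> V \<Longrightarrow> \<phi> g x \<in> V"
  using element_image by blast

lemma act_inv_left:
  assumes "g \<in> carrier \<Gamma>" "x \<in> V" shows "\<phi> (inv g) (\<phi> g x) = x"
  using orbit_sym_aux[OF assms] by simp

lemma act_inv_right:
  assumes "g \<in> carrier \<Gamma>" "x \<in> V" shows "\<phi> g (\<phi> (inv g) x) = x"
  using act_inv_left[of "inv g" x] assms grp by (simp add: group.inv_closed group.inv_inv)

definition hull_act :: "'a \<Rightarrow> ('v \<Rightarrow> nat) \<Rightarrow> ('v \<Rightarrow> nat)" where
  "hull_act g = (\<lambda>f\<in>inj_hull. \<lambda>x\<in>V. f (\<phi> (inv g) x))"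

lemma hull_act_apply:
  "f \<in> inj_hull \<Longrightarrow> x \<in> V \<Longrightarrow> hull_act g f x = f (\<phi> (inv g) x)"
  by (simp add: hull_act_def)

lemma isom_inv:
  assumes g: "g \<in> carrier \<Gamma>" and V: "x \<in> V" "y \<in> V"
  shows "d (\<phi> (inv g) x) y = d x (\<phi> g y)"
  using isom[OF g act_in[OF group.inv_closed[OF grp g] V(1)] V(2)] act_inv_right[OF g V(1)]
  by simp

lemma hull_act_in:
  assumes g: "g \<in> carrier \<Gamma>" and f: "f \<in> inj_hull"
  shows "hull_act g f \<in> inj_hull"
proof -
  have ig: "inv g \<in> carrier \<Gamma>" using g grp by (simp add: group.inv_closed)
  have "d x y \<le> hull_act g f x + hull_act g f y" if V: "x \<in> V" "y \<in> V" for x y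
    using hull_ge[OF f act_in[OF ig V(1)] act_in[OF ig V(2)]] isom[OF ig V]
    by (simp add: hull_act_apply f V)
  moreover have "\<exists>y\<in>V. hull_act g f x + hull_act g f y = d x y" if x: "x \<in> V" for x
  proof -
    obtain y where y: "y \<in> V" "f (\<phi> (inv g) x) + f y = d (\<phi> (inv g) x) y"
      using hull_attained[OF f act_in[OF ig x]] .
    then have "hull_act g f x + hull_act g f (\<phi> g y) = d x (\<phi> g y)"
      using x y by (simp add: hull_act_apply f act_in g act_inv_left isom_inv)
    then show ?thesis using act_in[OF g y(1)] by blast
  qed
  moreover have "hull_act g f \<in> extensional V" using f by (simp add: hull_act_def)
  ultimately show ?thesis unfolding inj_hull_def by blast
qed

lemma hull_act_mult:
  assumes g: "g \<in> carrier \<Gamma>" and h: "h \<in> carrier \<Gamma>" and f: "f \<in> inj_hull"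
  shows "hull_act (g \<otimes> h) f = hull_act g (hull_act h f)"
proof (rule hull_eqI)
  show "hull_act (g \<otimes> h) f \<in> inj_hull" "hull_act g (hull_act h f) \<in> inj_hull"
    using assms grp by (auto intro!: hull_act_in simp: group.is_monoid monoid.m_closed)
  fix x assume x: "x \<in> V"
  have "inv (g \<otimes> h) = inv h \<otimes> inv g" using grp g h by (simp add: group.inv_mult_group)
  then show "hull_act (g \<otimes> h) f x = hull_act g (hull_act h f) x"
    using x f g h grp
    by (simp add: hull_act_apply hull_act_in act_in composition_rule group.inv_closed)
qed

lemma hull_act_inv:
  assumes g: "g \<in> carrier \<Gamma>" and f: "f \<in> inj_hull"
  shows "hull_act g (hull_act (inv g) f) = f" "hull_act (inv g) (hull_act g f) = f"
  using g f grp
  by (auto intro!: hull_eqI hull_act_in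
      simp: hull_act_apply hull_act_in act_in act_inv_left act_inv_right
        group.inv_closed group.inv_inv)

lemma hull_group_action: "group_action \<Gamma> inj_hull hull_act"
proof -
  have bij: "hull_act g \<in> Bij inj_hull" if g: "g \<in> carrier \<Gamma>" for g
  proof -
    have "bij_betw (hull_act g) inj_hull inj_hull"
      using g grp
      by (intro bij_betw_byWitness[where f' = "hull_act (inv g)"])
        (auto simp: hull_act_inv hull_act_in group.inv_closed)
    then show ?thesis by (simp add: Bij_def hull_act_def)
  qed
  show ?thesis
  proof (intro group_action.intro group_hom.intro group_hom_axioms.intro grp group_BijGroup homI)
    fix g assume "g \<in> carrier \<Gamma>"
    then show "hull_act g \<in> carrier (BijGroup inj_hull)" using bij by (simp add: BijGroup_def)
  next
    fix g h assume gh: "g \<in> carrier \<Gamma>" "h \<in> carrier \<Gamma>"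
    have "hull_act (g \<otimes> h) = compose inj_hull (hull_act g) (hull_act h)"
    proof (rule extensionalityI[of _ inj_hull])
      fix f assume "f \<in> inj_hull"
      then show "hull_act (g \<otimes> h) f = compose inj_hull (hull_act g) (hull_act h) f"
        using gh by (simp add: compose_def hull_act_mult)
    qed (simp_all add: hull_act_def compose_def)
    then show "hull_act (g \<otimes> h) = hull_act g \<otimes>\<^bsub>BijGroup inj_hull\<^esub> hull_act h"
      using bij gh by (simp add: BijGroup_def)
  qed
qed

lemma hull_act_close_iff:
  assumes g: "g \<in> carrier \<Gamma>" and f: "f \<in> inj_hull" and h: "h \<in> inj_hull"
  shows "close n (hull_act g f) (hull_act g h) \<longleftrightarrow> close n f h"
proof -
  have "close n (hull_act g f) (hull_act g h)"
    if "g \<in> carrier \<Gamma>" "f \<in> inj_hull" "h \<in> inj_hull" "close n f h" for g f h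
    using that grp by (simp add: close_def hull_act_apply act_in group.inv_closed)
  from this[of g f h] this[of "inv g" "hull_act g f" "hull_act g h"] show ?thesis
    using g f h grp by (auto simp: hull_act_in hull_act_inv group.inv_closed)
qed

lemma hull_act_edge_iff:
  assumes g: "g \<in> carrier \<Gamma>" and f: "f \<in> inj_hull" and h: "h \<in> inj_hull"
  shows "(hull_act g f, hull_act g h) \<in> hull_edges \<longleftrightarrow> (f, h) \<in> hull_edges"
  using assms hull_act_in[OF g] hull_act_close_iff[OF assms] hull_act_inv(2)[OF g]
  by (auto simp: hull_edges_def) metis

text \<open>
  The elements that carry \<open>x\<close> to \<open>y\<close> form a coset of the stabilizer of \<open>x\<close>, or none exist.
\<close>

lemma finite_transporter:
  assumes st: "finite (stabilizer \<Gamma> \<phi> x)" and x: "x \<in> V"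
  shows "finite {g \<in> carrier \<Gamma>. \<phi> g x = y}"
proof (cases "\<exists>h\<in>carrier \<Gamma>. \<phi> h x = y")
  case True
  then obtain h where h: "h \<in> carrier \<Gamma>" "\<phi> h x = y" by blast
  interpret G: group \<Gamma> by (rule grp)
  have "g \<in> (\<lambda>s. h \<otimes> s) ` stabilizer \<Gamma> \<phi> x" if g: "g \<in> carrier \<Gamma>" "\<phi> g x = y" for g
  proof (rule image_eqI)
    show "g = h \<otimes> (inv h \<otimes> g)" using g h by (simp add: G.inv_solve_left G.m_assoc[symmetric])
    show "inv h \<otimes> g \<in> stabilizer \<Gamma> \<phi> x"
      using g h x act_inv_left[OF h(1) x] by (simp add: stabilizer_def composition_rule)
  qed
  then have "{g \<in> carrier \<Gamma>. \<phi> g x = y} \<subseteq> (\<lambda>s. h \<otimes> s) ` stabilizer \<Gamma> \<phi> x" by blast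
  then show ?thesis using st by (meson finite_imageI finite_subset)
next
  case False
  then have "{g \<in> carrier \<Gamma>. \<phi> g x = y} = {}" by blast
  then show ?thesis by (rule ssubst) simp
qed

text \<open>
  Neighbours of \<open>f\<close> have values at most \<open>f x + 1\<close> at \<open>x\<close>, so finite sublevel sets give local
  finiteness. The stabilizer of \<open>f\<close> moves \<open>x\<close> within the level set of \<open>f\<close> through \<open>x\<close>, which
  lies in the ball of radius \<open>2 * f x\<close> about \<open>x\<close> because \<open>d x y \<le> f x + f y\<close>. For cocompactness,
  a vertex where \<open>f\<close> is at most \<open>N\<close> is translated to an orbit representative.
\<close>

lemma hull_geometric_action:
  assumes ne: "V \<noteq> {}"
    and balls: "\<And>x n. x \<in> V \<Longrightarrow> finite {y \<in> V. d x y \<le> n}"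
    and sub: "\<And>x n. x \<in> V \<Longrightarrow> finite {f \<in> inj_hull. f x \<le> n}"
    and near: "\<And>f. f \<in> inj_hull \<Longrightarrow> \<exists>x\<in>V. f x \<le> N"
    and st: "\<And>x. x \<in> V \<Longrightarrow> finite (stabilizer \<Gamma> \<phi> x)"
    and orb: "finite (orbits \<Gamma> V \<phi>)"
  shows "geometric_action \<Gamma> inj_hull hull_edges hull_act"
  unfolding geometric_action_def
proof (intro conjI ballI hull_group_action)
  obtain x0 where x0: "x0 \<in> V" using ne by blast
  show "locally_finite_graph inj_hull hull_edges"
    unfolding locally_finite_graph_def
  proof (intro conjI ballI hull_simple)
    fix f assume "f \<in> inj_hull"
    have "hull_edges `` {f} \<subseteq> {h \<in> inj_hull. h x0 \<le> f x0 + 1}"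
      using x0 by (auto simp: hull_edges_def close_def)
    then show "finite (hull_edges `` {f})" using sub[OF x0] finite_subset by blast
  qed
next
  fix g f h assume "g \<in> carrier \<Gamma>" "f \<in> inj_hull" "h \<in> inj_hull"
  then show "(hull_act g f, hull_act g h) \<in> hull_edges \<longleftrightarrow> (f, h) \<in> hull_edges"
    by (rule hull_act_edge_iff)
next
  fix f assume f: "f \<in> inj_hull"
  obtain x where x: "x \<in> V" using ne by blast
  define B where "B = {y \<in> V. d x y \<le> 2 * f x}"
  have "\<phi> g x \<in> B" if "g \<in> stabilizer \<Gamma> hull_act f" for g
  proof -
    have g: "g \<in> carrier \<Gamma>" and fix_f: "hull_act g f = f"
      using that by (auto simp: stabilizer_def)
    have "f (\<phi> g x) = f x"
      using hull_act_apply[OF f act_in[OF g x], of g] fix_f act_inv_left[OF g x] by simp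
    then show ?thesis using hull_ge[OF f x act_in[OF g x]] act_in[OF g x] by (simp add: B_def)
  qed
  then have "stabilizer \<Gamma> hull_act f \<subseteq> (\<Union>y\<in>B. {g \<in> carrier \<Gamma>. \<phi> g x = y})"
    using group_action.stabilizer_subset[OF hull_group_action] by blast
  moreover have "finite (\<Union>y\<in>B. {g \<in> carrier \<Gamma>. \<phi> g x = y})"
    unfolding B_def by (intro finite_UN_I balls[OF x] finite_transporter[OF st[OF x] x])
  ultimately show "finite (stabilizer \<Gamma> hull_act f)" by (rule finite_subset)
next
  interpret H: group_action \<Gamma> inj_hull hull_act by (rule hull_group_action)
  have "\<forall>Q\<in>orbits \<Gamma> V \<phi>. \<exists>x. x \<in> V \<and> orbit \<Gamma> \<phi> x = Q" by (auto simp: orbits_def)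
  from bchoice[OF this] obtain rep
    where rep_in: "\<And>Q. Q \<in> orbits \<Gamma> V \<phi> \<Longrightarrow> rep Q \<in> V"
      and rep_orbit: "\<And>Q. Q \<in> orbits \<Gamma> V \<phi> \<Longrightarrow> orbit \<Gamma> \<phi> (rep Q) = Q"
    by blast
  define S where "S = (\<Union>x\<in>rep ` orbits \<Gamma> V \<phi>. {f \<in> inj_hull. f x \<le> N})"
  have fS: "finite S" using orb rep_in sub by (auto simp: S_def)
  have "orbit \<Gamma> hull_act f \<in> orbit \<Gamma> hull_act ` S" if f: "f \<in> inj_hull" for f
  proof -
    obtain x where x: "x \<in> V" "f x \<le> N" using near[OF f] by blast
    define y where "y = rep (orbit \<Gamma> \<phi> x)"
    have Q: "orbit \<Gamma> \<phi> x \<in> orbits \<Gamma> V \<phi>" using x by (auto simp: orbits_def)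
    have y: "y \<in> V" using rep_in[OF Q] by (simp add: y_def)
    then have "y \<in> orbit \<Gamma> \<phi> x" using orbit_refl[of y] rep_orbit[OF Q] by (simp add: y_def)
    then obtain g where g: "g \<in> carrier \<Gamma>" "\<phi> g x = y" by (auto simp: orbit_def)
    have k: "hull_act g f \<in> inj_hull" using g f by (intro hull_act_in)
    have "hull_act g f y = f x"
      using hull_act_apply[OF f y, of g] g act_inv_left[OF g(1) x(1)] by simp
    then have S: "hull_act g f \<in> S"
      unfolding S_def using Q x(2) k by (intro UN_I[of y] imageI) (simp_all add: y_def)
    have "hull_act g f \<in> orbit \<Gamma> hull_act f" using g by (auto simp: orbit_def)
    moreover from this have "f \<in> orbit \<Gamma> hull_act (hull_act g f)"
      by (rule H.orbit_sym[OF f k])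
    moreover have "orbit \<Gamma> hull_act b \<subseteq> orbit \<Gamma> hull_act a"
      if "a \<in> inj_hull" "b \<in> inj_hull" "b \<in> orbit \<Gamma> hull_act a" for a b
    proof
      fix c assume c: "c \<in> orbit \<Gamma> hull_act b"
      then have "c \<in> inj_hull" using that(2) hull_act_in by (auto simp: orbit_def)
      then show "c \<in> orbit \<Gamma> hull_act a" using H.orbit_trans that c by blast
    qed
    ultimately have "orbit \<Gamma> hull_act f = orbit \<Gamma> hull_act (hull_act g f)"
      using f k by blast
    then show ?thesis using S by blast
  qed
  then have "orbits \<Gamma> inj_hull hull_act \<subseteq> orbit \<Gamma> hull_act ` S" by (auto simp: orbits_def)
  then show "finite (orbits \<Gamma> inj_hull hull_act)" using fS by (meson finite_imageI finite_subset)
qed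

end

section \<open>Geometric actions on coarse Helly graphs\<close>

lemma automorphism_preserves_gdist:
  assumes c: "connected_graph V E" and ga: "group_action \<Gamma> V \<phi>"
    and aut: "\<And>u v. u \<in> V \<Longrightarrow> v \<in> V \<Longrightarrow> (\<phi> g u, \<phi> g v) \<in> E \<longleftrightarrow> (u, v) \<in> E"
    and g: "g \<in> carrier \<Gamma>" and V: "x \<in> V" "y \<in> V"
  shows "gdist E (\<phi> g x) (\<phi> g y) = gdist E x y"
proof -
  interpret A: group_action \<Gamma> V \<phi> by (rule ga)
  have EV: "E \<subseteq> V \<times> V" using c by (simp add: connected_graph_def simple_graph_def)
  have "(\<phi> g x, \<phi> g y) \<in> E ^^ n \<longleftrightarrow> (x, y) \<in> E ^^ n" for n
    using V(2)
  proof (induction n arbitrary: y)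
    case 0
    then show ?case using A.inj_prop[OF g] V(1) by (auto simp: inj_on_eq_iff)
  next
    case (Suc n)
    have "(\<phi> g x, \<phi> g y) \<in> E ^^ Suc n \<longleftrightarrow> (\<exists>w\<in>V. (\<phi> g x, w) \<in> E ^^ n \<and> (w, \<phi> g y) \<in> E)"
      using EV by auto
    also have "\<dots> \<longleftrightarrow> (\<exists>w\<in>V. (\<phi> g x, \<phi> g w) \<in> E ^^ n \<and> (\<phi> g w, \<phi> g y) \<in> E)"
      by (subst (1) A.surj_prop[OF g, symmetric]) simp
    also have "\<dots> \<longleftrightarrow> (\<exists>w\<in>V. (x, w) \<in> E ^^ n \<and> (w, y) \<in> E)"
      using Suc aut by auto
    also have "\<dots> \<longleftrightarrow> (x, y) \<in> E ^^ Suc n" using EV by auto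
    finally show ?case .
  qed
  then show ?thesis by (simp add: gdist_def)
qed

text \<open>
  The infimum in the Hausdorff distance need not be attained, hence the slack of one before
  rounding down.
\<close>

lemma stable_intervals_nat:
  assumes c: "connected_graph V E" and st: "stable_intervals V E \<beta>"
    and w: "w \<in> V" and vv: "(v, v') \<in> E" and a: "a \<in> interval V E w v"
  shows "\<exists>b\<in>interval V E w v'. gdist E a b \<le> nat \<lfloor>\<beta> + 1\<rfloor>"
proof -
  interpret conn_graph V E using c by unfold_locales
  have V: "v \<in> V" "v' \<in> V" using vv edge_verts by auto
  have "hausdorff_dist V E (interval V E w v) (interval V E w v') < ereal (\<beta> + 1)"
    using st w V vv unfolding stable_intervals_def
    by (meson ereal_less_eq(3) le_less_trans less_add_one less_ereal.simps(1))
  then obtain e where e: "e < \<beta> + 1"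
    "interval V E w v \<subseteq> (\<Union>b\<in>interval V E w v'. gball V E b e)"
    unfolding hausdorff_dist_def Inf_less_iff by auto
  then obtain b where b: "b \<in> interval V E w v'" "a \<in> gball V E b e" using a by blast
  then have "real (gdist E b a) \<le> \<beta> + 1" using e by (simp add: gball_def)
  then have "gdist E b a \<le> nat \<lfloor>\<beta> + 1\<rfloor>" by (rule le_nat_floor)
  then show ?thesis using b d_sym[of a b] a by (auto simp: interval_def)
qed

theorem theorem1p2:
  fixes V :: "'v set" and E :: "'v rel" and \<beta> :: real
    and \<Gamma> :: "('g, 'm) monoid_scheme" and \<phi> :: "'g \<Rightarrow> 'v \<Rightarrow> 'v"
  assumes "locally_finite_graph V E"
    and "connected_graph V E"
    and "coarse_helly V E"
    and "\<beta> \<ge> 1"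
    and "stable_intervals V E \<beta>"
    and "geometric_action \<Gamma> V E \<phi>"
  shows "helly_group \<Gamma>"
proof -
  have ne: "V \<noteq> {}" using assms(2) by (simp add: connected_graph_def)
  have ga: "group_action \<Gamma> V \<phi>"
    and aut: "\<And>g u v. g \<in> carrier \<Gamma> \<Longrightarrow> u \<in> V \<Longrightarrow> v \<in> V \<Longrightarrow> (\<phi> g u, \<phi> g v) \<in> E \<longleftrightarrow> (u, v) \<in> E"
    and st: "\<And>v. v \<in> V \<Longrightarrow> finite (stabilizer \<Gamma> \<phi> v)"
    and orb: "finite (orbits \<Gamma> V \<phi>)"
    using assms(6) by (auto simp: geometric_action_def)
  interpret stable_graph V E "nat \<lfloor>\<beta> + 1\<rfloor>"
    using assms(2) stable_intervals_nat[OF assms(2,5)] by unfold_locales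
  interpret A: group_action \<Gamma> V \<phi> by (rule ga)
  interpret isometric_action V "gdist E" \<Gamma> \<phi>
    using automorphism_preserves_gdist[OF assms(2) ga aut] by unfold_locales
  obtain N where near: "\<And>f. f \<in> inj_hull \<Longrightarrow> \<exists>x\<in>V. f x \<le> N"
    using coarse_helly_near_vertex[OF assms(3)] by blast
  have "geometric_action \<Gamma> inj_hull hull_edges hull_act"
    using finite_balls[OF assms(1)] finite_hull_sublevel[OF assms(1)]
    by (rule hull_geometric_action[OF ne _ _ near st orb])
  with hull_helly[OF ne] show ?thesis by (rule helly_groupI)
qed

end
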